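(* Let $G$ be a locally compact Hausdorff topological groupoid, let $(S_G,\ast)$ and $(S'_G,\star)$ be the associated monoids, and let $j:G\to G$, $j(x)=x^{-1}$. Then: (1) $j\in S_G\cap S'_G$, and $j$ is an idempotent and a right zero element of each of the two semigroups $S_G$ and $S'_G$. (2) $j$ is a left zero of $S_G$ (i.e. $j\ast f=j$ for all $f\in S_G$) if and only if $f(u)=u$ for every $f\in S_G$ and $u\in G^0$. Similarly, $j$ is a left zero of $S'_G$ (i.e. $j\star f=j$ for all $f\in S'_G$) if and only if $f(u)=u$ for every $f\in S'_G$ and $u\in G^0$. (3) $S_G\cap S'_G$ is a left ideal of $S_G$ and a left ideal of $S'_G$. (4) $jS_G=\{j\ast f: f\in S_G\}$ is a minimal ideal of $S_G$, and $jS'_G=\{j\star f: f\in S'_G\}$ is a minimal ideal of $S'_G$. (5) If $\phi\in S_G$ is a bijection, then $\phi^{-1}\in S'_G$, where $\phi^{-1}$ is the inverse function: $\phi^{-1}(\phi(x))=x=\phi(\phi^{-1}(x))$ for every $x\in G$. (6) The only element of $S_G$ that is an injective antihomomorphism and is also an idempotent of $S_G$ is $j$. (7) The only element of $S_G$ that is an antihomomorphism and is also a right zero element of $S_G$ is $j$. (8) If $f\in S_G\cap S'_G$ is an antihomomorphism, then $f\star f=f\ast f$.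
   Context: A groupoid $G$ has a partially defined product $(x,y)\mapsto xy$ on the set $G^2\subset G\times G$ of composable pairs, and an inverse map $x\mapsto x^{-1}$. Put $r(x)=xx^{-1}$ and $d(x)=x^{-1}x$; a pair $(x,y)$ is composable if and only if $d(x)=r(y)$. The unit space is $G^0=r(G)=d(G)$, and for $u\in G^0$, $G^u=r^{-1}(u)$ and $G_u=d^{-1}(u)$. A topological groupoid is a groupoid with a topology for which the inverse map and the product map $G^2\to G$ ($G^2$ with the topology induced from $G\times G$) are continuous; topologies are assumed locally compact and Hausdorff. $C(G,G)$ is the set of continuous maps from $G$ to $G$. Define $$S_G=\{f\in C(G,G): f(x)\in G_{r(x)}\text{ for all }x\in G\},\qquad S'_G=\{f\in C(G,G): f(x)\in G^{d(x)}\text{ for all }x\in G\}.$$ $S_G$ is a monoid with operation $(f\ast g)(x)=g(f(x)x)f(x)$ and identity $r$; $S'_G$ is a monoid with operation $(h\star k)(x)=h(x)k(xh(x))$ and identity $d$. A map $\psi:G\to G$ is an antihomomorphism if $(x,y)\in G^2$ implies $(\psi(y),\psi(x))\in G^2$ and $\psi(xy)=\psi(y)\psi(x)$. For a semigroup $S$: an element $e$ is idempotent if $ee=e$; an element $z$ is a right zero if $sz=z$ for all $s\in S$. A nonempty subset $T\subset S$ is a left ideal if $ST\subset T$, a right ideal if $TS\subset T$, and an ideal if it is both; an ideal of $S$ is minimal if it properly contains no ideal of $S$.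
   Formalization: In (5), φ^{-1} ∈ S'_G is shown only when φ is a homeomorphism; for an arbitrary bijection φ ∈ S_G only φ^{-1}(x) ∈ G^{d(x)} is shown, because the inverse of a continuous bijection of a locally compact Hausdorff space need not be continuous, so (5) fails as written. *)

theory Defs
  imports "HOL-Analysis.Analysis" "HOL-Algebra.Group"
begin

section \<open>Topological groupoids\<close>

text \<open>The underlying set of the groupoid is the carrier of its topology. The product is a total
  function, of which only the values on composable pairs matter.\<close>

record 'a groupoid =
  topo :: "'a topology"
  composable :: "('a \<times> 'a) set"
  gmult :: "'a \<Rightarrow> 'a \<Rightarrow> 'a"  (infixl \<open>\<cdot>\<index>\<close> 70)
  ginv :: "'a \<Rightarrow> 'a"

definition arrows :: "('a, 'b) groupoid_scheme \<Rightarrow> 'a set" where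
  "arrows G = topspace (topo G)"

definition rng :: "('a, 'b) groupoid_scheme \<Rightarrow> 'a \<Rightarrow> 'a" where
  "rng G x = x \<cdot>\<^bsub>G\<^esub> ginv G x"

definition src :: "('a, 'b) groupoid_scheme \<Rightarrow> 'a \<Rightarrow> 'a" where
  "src G x = ginv G x \<cdot>\<^bsub>G\<^esub> x"

definition unit_space :: "('a, 'b) groupoid_scheme \<Rightarrow> 'a set" where
  "unit_space G = rng G ` arrows G"

text \<open>$G^u = r^{-1}(u)$ and $G_u = d^{-1}(u)$.\<close>

definition rng_fibre :: "('a, 'b) groupoid_scheme \<Rightarrow> 'a \<Rightarrow> 'a set" where
  "rng_fibre G u = {x \<in> arrows G. rng G x = u}"

definition src_fibre :: "('a, 'b) groupoid_scheme \<Rightarrow> 'a \<Rightarrow> 'a set" where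
  "src_fibre G u = {x \<in> arrows G. src G x = u}"

text \<open>The usual axioms of a groupoid given by a partial product and an inverse map; that
  \<open>(x, y)\<close> is composable iff \<open>src G x = rng G y\<close> follows (lemma \<open>composable_iff\<close>).\<close>

locale groupoid =
  fixes G :: "('a, 'b) groupoid_scheme" (structure)
  assumes composable_subset: "composable G \<subseteq> arrows G \<times> arrows G"
    and gmult_closed: "(x, y) \<in> composable G \<Longrightarrow> x \<cdot> y \<in> arrows G"
    and ginv_closed: "x \<in> arrows G \<Longrightarrow> ginv G x \<in> arrows G"
    and ginv_ginv: "x \<in> arrows G \<Longrightarrow> ginv G (ginv G x) = x"
    and assoc_composable:
      "(x, y) \<in> composable G \<Longrightarrow> (y, z) \<in> composable G \<Longrightarrow>
        (x \<cdot> y, z) \<in> composable G \<and> (x, y \<cdot> z) \<in> composable G \<and> (x \<cdot> y) \<cdot> z = x \<cdot> (y \<cdot> z)"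
    and ginv_left_composable: "x \<in> arrows G \<Longrightarrow> (ginv G x, x) \<in> composable G"
    and ginv_left_cancel: "(x, y) \<in> composable G \<Longrightarrow> ginv G x \<cdot> (x \<cdot> y) = y"
    and ginv_right_composable: "x \<in> arrows G \<Longrightarrow> (x, ginv G x) \<in> composable G"
    and ginv_right_cancel: "(z, x) \<in> composable G \<Longrightarrow> (z \<cdot> x) \<cdot> ginv G x = z"

locale lch_groupoid = groupoid +
  assumes continuous_ginv: "continuous_map (topo G) (topo G) (ginv G)"
    and continuous_gmult:
      "continuous_map (subtopology (prod_topology (topo G) (topo G)) (composable G)) (topo G)
        (\<lambda>(x, y). x \<cdot> y)"
    and locally_compact: "locally_compact_space (topo G)"
    and Hausdorff: "Hausdorff_space (topo G)"

context groupoid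
begin

lemma composable_iff:
  "(x, y) \<in> composable G \<longleftrightarrow> x \<in> arrows G \<and> y \<in> arrows G \<and> src G x = rng G y"
proof
  assume xy: "(x, y) \<in> composable G"
  then have x: "x \<in> arrows G" and y: "y \<in> arrows G"
    using composable_subset by auto
  have "src G x = (ginv G x \<cdot> x \<cdot> y) \<cdot> ginv G y"
    using ginv_right_cancel assoc_composable[OF ginv_left_composable[OF x] xy]
      assoc_composable ginv_left_composable[OF x] xy
    unfolding src_def by metis
  also have "\<dots> = y \<cdot> ginv G y"
    using assoc_composable[OF ginv_left_composable[OF x] xy] ginv_left_cancel[OF xy] by simp
  finally show "x \<in> arrows G \<and> y \<in> arrows G \<and> src G x = rng G y"
    using x y by (simp add: rng_def)
next
  assume *: "x \<in> arrows G \<and> y \<in> arrows G \<and> src G x = rng G y"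
  then have "(x, src G x) \<in> composable G" "(src G x, y) \<in> composable G"
    using assoc_composable[OF ginv_right_composable ginv_left_composable, of x]
      assoc_composable[OF ginv_right_composable ginv_left_composable, of y]
    by (auto simp: src_def rng_def ginv_closed)
  moreover from this have "x \<cdot> src G x = x"
    using * unfolding src_def
    by (metis assoc_composable ginv_left_composable ginv_right_cancel ginv_ginv ginv_closed
        ginv_right_composable)
  ultimately show "(x, y) \<in> composable G"
    using assoc_composable by metis
qed

end

section \<open>The monoids of continuous self-maps\<close>

text \<open>Maps from \<open>G\<close> to \<open>G\<close> are represented by functions that are extensional on \<open>arrows G\<close>, so
  that equality of functions is equality of maps.\<close>

definition cmaps :: "('a, 'b) groupoid_scheme \<Rightarrow> ('a \<Rightarrow> 'a) set" where
  "cmaps G = {f \<in> extensional (arrows G). continuous_map (topo G) (topo G) f}"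

definition SG :: "('a, 'b) groupoid_scheme \<Rightarrow> ('a \<Rightarrow> 'a) monoid" where
  "SG G =
    \<lparr>carrier = {f \<in> cmaps G. \<forall>x\<in>arrows G. f x \<in> src_fibre G (rng G x)},
     mult = (\<lambda>f g. \<lambda>x\<in>arrows G. g (f x \<cdot>\<^bsub>G\<^esub> x) \<cdot>\<^bsub>G\<^esub> f x),
     one = (\<lambda>x\<in>arrows G. rng G x)\<rparr>"

definition SG' :: "('a, 'b) groupoid_scheme \<Rightarrow> ('a \<Rightarrow> 'a) monoid" where
  "SG' G =
    \<lparr>carrier = {f \<in> cmaps G. \<forall>x\<in>arrows G. f x \<in> rng_fibre G (src G x)},
     mult = (\<lambda>h k. \<lambda>x\<in>arrows G. h x \<cdot>\<^bsub>G\<^esub> k (x \<cdot>\<^bsub>G\<^esub> h x)),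
     one = (\<lambda>x\<in>arrows G. src G x)\<rparr>"

definition jmap :: "('a, 'b) groupoid_scheme \<Rightarrow> 'a \<Rightarrow> 'a" where
  "jmap G = (\<lambda>x\<in>arrows G. ginv G x)"

text \<open>The inverse of a bijection \<open>f\<close> of \<open>arrows G\<close>. It need not be continuous, even if \<open>f\<close> is and the
  topology is locally compact Hausdorff.\<close>

definition inverse_map :: "('a, 'b) groupoid_scheme \<Rightarrow> ('a \<Rightarrow> 'a) \<Rightarrow> 'a \<Rightarrow> 'a" where
  "inverse_map G f = (\<lambda>x\<in>arrows G. inv_into (arrows G) f x)"

definition antihom :: "('a, 'b) groupoid_scheme \<Rightarrow> ('a \<Rightarrow> 'a) \<Rightarrow> bool" where
  "antihom G f \<longleftrightarrow> f \<in> arrows G \<rightarrow> arrows G \<and>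
    (\<forall>x y. (x, y) \<in> composable G \<longrightarrow>
      (f y, f x) \<in> composable G \<and> f (x \<cdot>\<^bsub>G\<^esub> y) = f y \<cdot>\<^bsub>G\<^esub> f x)"

section \<open>Semigroup notions\<close>

definition idempotent_elem :: "('a, 'b) monoid_scheme \<Rightarrow> 'a \<Rightarrow> bool" where
  "idempotent_elem S e \<longleftrightarrow> e \<in> carrier S \<and> e \<otimes>\<^bsub>S\<^esub> e = e"

definition right_zero :: "('a, 'b) monoid_scheme \<Rightarrow> 'a \<Rightarrow> bool" where
  "right_zero S z \<longleftrightarrow> z \<in> carrier S \<and> (\<forall>s\<in>carrier S. s \<otimes>\<^bsub>S\<^esub> z = z)"

definition left_zero :: "('a, 'b) monoid_scheme \<Rightarrow> 'a \<Rightarrow> bool" where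
  "left_zero S z \<longleftrightarrow> z \<in> carrier S \<and> (\<forall>s\<in>carrier S. z \<otimes>\<^bsub>S\<^esub> s = z)"

definition left_ideal :: "('a, 'b) monoid_scheme \<Rightarrow> 'a set \<Rightarrow> bool" where
  "left_ideal S T \<longleftrightarrow> T \<noteq> {} \<and> T \<subseteq> carrier S \<and> (\<forall>s\<in>carrier S. \<forall>t\<in>T. s \<otimes>\<^bsub>S\<^esub> t \<in> T)"

definition right_ideal :: "('a, 'b) monoid_scheme \<Rightarrow> 'a set \<Rightarrow> bool" where
  "right_ideal S T \<longleftrightarrow> T \<noteq> {} \<and> T \<subseteq> carrier S \<and> (\<forall>s\<in>carrier S. \<forall>t\<in>T. t \<otimes>\<^bsub>S\<^esub> s \<in> T)"

definition two_sided_ideal :: "('a, 'b) monoid_scheme \<Rightarrow> 'a set \<Rightarrow> bool" where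
  "two_sided_ideal S T \<longleftrightarrow> left_ideal S T \<and> right_ideal S T"

definition minimal_ideal :: "('a, 'b) monoid_scheme \<Rightarrow> 'a set \<Rightarrow> bool" where
  "minimal_ideal S T \<longleftrightarrow> two_sided_ideal S T \<and> (\<nexists>I. two_sided_ideal S I \<and> I \<subset> T)"

end

theory Submission
  imports Defs
begin

text \<open>
  Two ideas carry the proof. The first is duality. Reversing the multiplication of a groupoid
  exchanges range and source, so the monoid \<open>SG'\<close> of a groupoid is the monoid \<open>SG\<close> of its opposite
  (\<open>SG_opposite\<close>), while \<open>jmap\<close> and the unit space do not change. The assertions that come in
  pairs, one for each monoid, are therefore one assertion about \<open>SG\<close>, read in the groupoid and in its
  opposite.

  The second is that the inversion \<open>j\<close> is a right zero: since \<open>(f(x) x)\<inverse> f(x) = x\<inverse>\<close>, one has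
  \<open>f \<ast> j = j\<close> for every \<open>f\<close>. In any semigroup a right zero \<open>z\<close> generates the minimal ideal \<open>z S\<close>,
  because an ideal that contains some \<open>t\<close> also contains \<open>t z = z\<close>. On the other side,
  \<open>(j \<ast> f)(x) = f(d(x)) x\<inverse>\<close>, so \<open>j\<close> is a left zero exactly when every \<open>f\<close> fixes the units.

  For an antihomomorphism \<open>f\<close>, the value \<open>f(d(x))\<close> is the unit \<open>r(f(x))\<close>, and hence
  \<open>f(x\<inverse>) = f(x)\<inverse>\<close>. If moreover \<open>f\<close> is idempotent, then \<open>f(x) f(f(x)) = f(f(x) x)\<close> is a unit, so
  \<open>f(f(x)) = f(x)\<inverse> = f(x\<inverse>)\<close>, and injectivity yields \<open>f = j\<close>. If instead \<open>f\<close> is a right zero, then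
  \<open>f(x) = (j \<ast> f)(x) = f(d(x)) x\<inverse>\<close>, which is \<open>x\<inverse>\<close> because \<open>f(d(x))\<close> is a unit.

  The assertion on inverses of bijections is a change of variable: the condition \<open>d(\<phi>(y)) = r(y)\<close> at
  \<open>y = \<phi>\<inverse>(x)\<close> says \<open>r(\<phi>\<inverse>(x)) = d(x)\<close>.
\<close>

section \<open>Calculus in a groupoid\<close>

context groupoid
begin

lemma composable_arrows:
  assumes "(x, y) \<in> composable G"
  shows "x \<in> arrows G" "y \<in> arrows G"
  using assms composable_subset by auto

lemma src_ginv: "x \<in> arrows G \<Longrightarrow> src G (ginv G x) = rng G x"
  by (simp add: src_def rng_def ginv_ginv)

lemma rng_ginv: "x \<in> arrows G \<Longrightarrow> rng G (ginv G x) = src G x"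
  by (simp add: src_def rng_def ginv_ginv)

lemma src_closed: "x \<in> arrows G \<Longrightarrow> src G x \<in> arrows G"
  unfolding src_def by (intro gmult_closed ginv_left_composable)

lemma rng_gmult:
  assumes "(x, y) \<in> composable G"
  shows "rng G (x \<cdot> y) = rng G x"
proof -
  have x: "x \<in> arrows G"
    using assms by (rule composable_arrows)
  have "(ginv G x, x \<cdot> y) \<in> composable G"
    using assoc_composable[OF ginv_left_composable[OF x] assms] by blast
  then show ?thesis
    using src_ginv[OF x] by (simp add: composable_iff)
qed

lemma src_gmult:
  assumes "(x, y) \<in> composable G"
  shows "src G (x \<cdot> y) = src G y"
proof -
  have y: "y \<in> arrows G"
    using assms by (rule composable_arrows)
  have "(x \<cdot> y, ginv G y) \<in> composable G"
    using assoc_composable[OF assms ginv_right_composable[OF y]] by blast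
  then show ?thesis
    using rng_ginv[OF y] by (simp add: composable_iff)
qed

lemma src_rng: "x \<in> arrows G \<Longrightarrow> src G (rng G x) = rng G x"
  using src_gmult[OF ginv_right_composable] src_ginv by (simp add: rng_def)

lemma rng_src: "x \<in> arrows G \<Longrightarrow> rng G (src G x) = src G x"
  using rng_gmult[OF ginv_left_composable] rng_ginv by (simp add: src_def)

lemma rng_left_unit: "x \<in> arrows G \<Longrightarrow> rng G x \<cdot> x = x"
  using ginv_right_cancel[OF ginv_right_composable] by (simp add: rng_def ginv_ginv)

lemma src_right_unit: "x \<in> arrows G \<Longrightarrow> x \<cdot> src G x = x"
  using ginv_left_cancel[OF ginv_left_composable] by (simp add: src_def ginv_ginv)

lemma left_unit_unique:
  assumes "(e, x) \<in> composable G" "e \<cdot> x = x"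
  shows "e = rng G x"
  using ginv_right_cancel[OF assms(1)] assms(2) by (simp add: rng_def)

lemma right_inverse_unique:
  assumes "(x, y) \<in> composable G" "x \<cdot> y = rng G x"
  shows "y = ginv G x"
proof -
  have x: "x \<in> arrows G"
    using assms(1) by (rule composable_arrows)
  have "y = ginv G x \<cdot> rng G x"
    using ginv_left_cancel[OF assms(1)] assms(2) by simp
  then show ?thesis
    using src_right_unit[OF ginv_closed[OF x]] src_ginv[OF x] by simp
qed

lemma ginv_gmult_cancel_left:
  assumes ab: "(a, b) \<in> composable G"
  shows "ginv G (a \<cdot> b) \<cdot> a = ginv G b"
proof -
  have b: "b \<in> arrows G" and c: "a \<cdot> b \<in> arrows G"
    using ab composable_arrows gmult_closed by auto
  have comp: "(ginv G (a \<cdot> b), a) \<in> composable G"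
    using ab c by (simp add: composable_iff ginv_closed src_ginv rng_gmult)
  note assoc = assoc_composable[OF comp ab]
  have "ginv G (a \<cdot> b) \<cdot> a = ginv G (a \<cdot> b) \<cdot> a \<cdot> b \<cdot> ginv G b"
    using assoc by (intro ginv_right_cancel[symmetric]) blast
  also have "\<dots> = src G b \<cdot> ginv G b"
    using assoc src_gmult[OF ab] by (simp add: src_def)
  also have "\<dots> = ginv G b"
    using rng_left_unit[OF ginv_closed[OF b]] rng_ginv[OF b] by simp
  finally show ?thesis .
qed

lemma unit_space_eq_src: "unit_space G = src G ` arrows G"
  unfolding unit_space_def
  by (auto simp: image_iff) (metis ginv_closed src_ginv rng_ginv)+

text \<open>Since \<open>f(x) = f(x d(x)) = f(d(x)) f(x)\<close>, the factor \<open>f(d(x))\<close> must be the unit \<open>r(f(x))\<close>.\<close>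

lemma antihom_src:
  assumes f: "antihom G f" and x: "x \<in> arrows G"
  shows "f (src G x) = rng G (f x)"
proof -
  have "(x, src G x) \<in> composable G"
    using x by (simp add: composable_iff src_closed rng_src)
  then have "(f (src G x), f x) \<in> composable G" "f (src G x) \<cdot> f x = f x"
    using f src_right_unit[OF x] unfolding antihom_def by force+
  then show ?thesis
    by (rule left_unit_unique)
qed

lemma antihom_ginv:
  assumes f: "antihom G f" and x: "x \<in> arrows G"
  shows "f (ginv G x) = ginv G (f x)"
proof (rule right_inverse_unique)
  show "(f x, f (ginv G x)) \<in> composable G"
    using f ginv_left_composable[OF x] unfolding antihom_def by blast
  show "f x \<cdot> f (ginv G x) = rng G (f x)"
    using f ginv_left_composable[OF x] antihom_src[OF f x] unfolding antihom_def src_def by metis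
qed

end

section \<open>The opposite groupoid\<close>

text \<open>Extension fields are dropped, so that \<open>opposite (opposite G) = G\<close> may fail; only the
  agreement of the associated monoids (lemma \<open>SG'_opposite\<close>) matters for duality.\<close>

definition opposite :: "('a, 'b) groupoid_scheme \<Rightarrow> 'a groupoid" where
  "opposite G = \<lparr>topo = topo G, composable = (composable G)\<inverse>,
     gmult = (\<lambda>x y. y \<cdot>\<^bsub>G\<^esub> x), ginv = ginv G\<rparr>"

lemma opposite_simps [simp]:
  "topo (opposite G) = topo G"
  "composable (opposite G) = (composable G)\<inverse>"
  "x \<cdot>\<^bsub>opposite G\<^esub> y = y \<cdot>\<^bsub>G\<^esub> x"
  "ginv (opposite G) = ginv G"
  "arrows (opposite G) = arrows G"
  "rng (opposite G) = src G"
  "src (opposite G) = rng G"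
  by (auto simp: opposite_def arrows_def rng_def src_def fun_eq_iff)

lemma fibre_opposite [simp]:
  "rng_fibre (opposite G) = src_fibre G"
  "src_fibre (opposite G) = rng_fibre G"
  by (auto simp: rng_fibre_def src_fibre_def fun_eq_iff)

lemma cmaps_opposite [simp]: "cmaps (opposite G) = cmaps G"
  by (simp add: cmaps_def)

lemma jmap_opposite [simp]: "jmap (opposite G) = jmap G"
  by (simp add: jmap_def)

lemma SG_opposite [simp]: "SG (opposite G) = SG' G"
  by (simp add: SG_def SG'_def)

lemma SG'_opposite [simp]: "SG' (opposite G) = SG G"
  by (simp add: SG_def SG'_def)

lemma (in groupoid) unit_space_opposite: "unit_space (opposite G) = unit_space G"
  unfolding unit_space_eq_src by (simp add: unit_space_def)

lemma (in groupoid) groupoid_opposite: "groupoid (opposite G)"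
  using composable_subset gmult_closed ginv_closed ginv_ginv assoc_composable
    ginv_left_composable ginv_left_cancel ginv_right_composable ginv_right_cancel
  by unfold_locales auto

lemma (in lch_groupoid) lch_groupoid_opposite: "lch_groupoid (opposite G)"
proof (intro lch_groupoid.intro lch_groupoid_axioms.intro groupoid_opposite)
  let ?T = "topo G"
  have swap: "continuous_map (subtopology (prod_topology ?T ?T) ((composable G)\<inverse>))
      (subtopology (prod_topology ?T ?T) (composable G)) (\<lambda>p. (snd p, fst p))"
    by (auto simp: continuous_map_in_subtopology
        intro!: continuous_map_from_subtopology continuous_map_pairedI
          continuous_map_fst continuous_map_snd)
  have "(\<lambda>(x, y). x \<cdot>\<^bsub>opposite G\<^esub> y) = (\<lambda>(x, y). x \<cdot> y) \<circ> (\<lambda>p. (snd p, fst p))"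
    by auto
  then show "continuous_map
      (subtopology (prod_topology (topo (opposite G)) (topo (opposite G))) (composable (opposite G)))
      (topo (opposite G)) (\<lambda>(x, y). x \<cdot>\<^bsub>opposite G\<^esub> y)"
    using continuous_map_compose[OF swap continuous_gmult] by simp
qed (simp_all add: continuous_ginv locally_compact Hausdorff)

section \<open>The monoid of maps into the source fibres\<close>

lemma SG_simps [simp]:
  "f \<otimes>\<^bsub>SG G\<^esub> g = (\<lambda>x\<in>arrows G. g (f x \<cdot>\<^bsub>G\<^esub> x) \<cdot>\<^bsub>G\<^esub> f x)"
  "\<one>\<^bsub>SG G\<^esub> = restrict (rng G) (arrows G)"
  by (simp_all add: SG_def)

lemma SG_eqI:
  assumes "f \<in> carrier (SG G)" "g \<in> carrier (SG G)" "\<And>x. x \<in> arrows G \<Longrightarrow> f x = g x"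
  shows "f = g"
  using assms by (auto simp: SG_def cmaps_def intro: extensionalityI)

lemma SG_fibre:
  assumes "f \<in> carrier (SG G)" "x \<in> arrows G"
  shows "f x \<in> arrows G" "src G (f x) = rng G x"
  using assms by (auto simp: SG_def src_fibre_def)

context lch_groupoid
begin

lemma continuous_map_gmult:
  assumes "continuous_map (topo G) (topo G) p" "continuous_map (topo G) (topo G) q"
    and "\<And>x. x \<in> arrows G \<Longrightarrow> (p x, q x) \<in> composable G"
  shows "continuous_map (topo G) (topo G) (\<lambda>x. p x \<cdot> q x)"
proof -
  have "continuous_map (topo G)
      (subtopology (prod_topology (topo G) (topo G)) (composable G)) (\<lambda>x. (p x, q x))"
    using assms by (auto simp: continuous_map_in_subtopology arrows_def
        intro: continuous_map_pairedI)
  from continuous_map_compose[OF this continuous_gmult] show ?thesis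
    by (simp add: o_def)
qed

lemma restrict_in_SG:
  assumes "continuous_map (topo G) (topo G) f"
    and "\<And>x. x \<in> arrows G \<Longrightarrow> src G (f x) = rng G x"
  shows "restrict f (arrows G) \<in> carrier (SG G)"
proof -
  have "continuous_map (topo G) (topo G) (restrict f (arrows G))"
    using assms(1) by (rule continuous_map_eq) (simp add: arrows_def)
  moreover have "f x \<in> arrows G" if "x \<in> arrows G" for x
    using continuous_map_funspace[OF assms(1)] that by (auto simp: arrows_def)
  ultimately show ?thesis
    using assms(2) by (auto simp: SG_def cmaps_def src_fibre_def)
qed

lemma SG_composable:
  assumes "f \<in> carrier (SG G)" "x \<in> arrows G"
  shows "(f x, x) \<in> composable G"
  using SG_fibre[OF assms] assms by (simp add: composable_iff)

lemma SG_mult_composable: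
  assumes f: "f \<in> carrier (SG G)" and g: "g \<in> carrier (SG G)" and x: "x \<in> arrows G"
  shows "(g (f x \<cdot> x), f x) \<in> composable G"
proof -
  have fx: "(f x, x) \<in> composable G"
    using f x by (rule SG_composable)
  then have "f x \<cdot> x \<in> arrows G"
    by (rule gmult_closed)
  from SG_fibre[OF g this] show ?thesis
    using rng_gmult[OF fx] SG_fibre[OF f x] by (simp add: composable_iff)
qed

lemma SG_mult_closed:
  assumes f: "f \<in> carrier (SG G)" and g: "g \<in> carrier (SG G)"
  shows "f \<otimes>\<^bsub>SG G\<^esub> g \<in> carrier (SG G)"
proof -
  have cont: "continuous_map (topo G) (topo G) f" "continuous_map (topo G) (topo G) g"
    using f g by (auto simp: SG_def cmaps_def)
  have "continuous_map (topo G) (topo G) (\<lambda>x. f x \<cdot> x)"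
    using cont SG_composable[OF f] by (intro continuous_map_gmult) auto
  from continuous_map_compose[OF this cont(2)]
  have "continuous_map (topo G) (topo G) (\<lambda>x. g (f x \<cdot> x) \<cdot> f x)"
    using cont SG_mult_composable[OF f g] by (intro continuous_map_gmult) (auto simp: o_def)
  then show ?thesis
    using src_gmult[OF SG_mult_composable[OF f g]] SG_fibre[OF f]
    by (auto intro!: restrict_in_SG)
qed

lemma SG_mult_assoc:
  assumes f: "f \<in> carrier (SG G)" and g: "g \<in> carrier (SG G)" and h: "h \<in> carrier (SG G)"
  shows "f \<otimes>\<^bsub>SG G\<^esub> g \<otimes>\<^bsub>SG G\<^esub> h = f \<otimes>\<^bsub>SG G\<^esub> (g \<otimes>\<^bsub>SG G\<^esub> h)"
proof (rule SG_eqI)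
  fix x assume x: "x \<in> arrows G"
  define y where "y = f x \<cdot> x"
  have y: "y \<in> arrows G"
    unfolding y_def using SG_composable[OF f x] by (rule gmult_closed)
  have gf: "(g y, f x) \<in> composable G"
    unfolding y_def using f g x by (rule SG_mult_composable)
  have "g y \<cdot> f x \<cdot> x = g y \<cdot> y"
    using assoc_composable[OF gf SG_composable[OF f x]] by (simp add: y_def)
  moreover have "h (g y \<cdot> y) \<cdot> g y \<cdot> f x = h (g y \<cdot> y) \<cdot> (g y \<cdot> f x)"
    using assoc_composable[OF SG_mult_composable[OF g h y] gf] by blast
  ultimately show "(f \<otimes>\<^bsub>SG G\<^esub> g \<otimes>\<^bsub>SG G\<^esub> h) x = (f \<otimes>\<^bsub>SG G\<^esub> (g \<otimes>\<^bsub>SG G\<^esub> h)) x"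
    using x y by (simp add: y_def)
qed (intro SG_mult_closed f g h)+

lemma monoid_SG: "monoid (SG G)"
proof (rule monoidI)
  have "continuous_map (topo G) (topo G) (rng G)"
    unfolding rng_def using continuous_ginv ginv_right_composable
    by (intro continuous_map_gmult) auto
  then show one: "\<one>\<^bsub>SG G\<^esub> \<in> carrier (SG G)"
    by (simp add: restrict_in_SG src_rng)
  fix f assume f: "f \<in> carrier (SG G)"
  show "\<one>\<^bsub>SG G\<^esub> \<otimes>\<^bsub>SG G\<^esub> f = f"
  proof (rule SG_eqI)
    fix x assume "x \<in> arrows G"
    then show "(\<one>\<^bsub>SG G\<^esub> \<otimes>\<^bsub>SG G\<^esub> f) x = f x"
      using src_right_unit[OF SG_fibre(1)[OF f]] SG_fibre(2)[OF f] by (simp add: rng_left_unit)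
  qed (intro SG_mult_closed one f)+
  show "f \<otimes>\<^bsub>SG G\<^esub> \<one>\<^bsub>SG G\<^esub> = f"
  proof (rule SG_eqI)
    fix x assume "x \<in> arrows G"
    then show "(f \<otimes>\<^bsub>SG G\<^esub> \<one>\<^bsub>SG G\<^esub>) x = f x"
      using SG_composable[OF f] SG_fibre(1)[OF f]
      by (simp add: gmult_closed rng_gmult rng_left_unit)
  qed (intro SG_mult_closed one f)+
qed (intro SG_mult_closed SG_mult_assoc; assumption)+

text \<open>The product \<open>s \<ast> t\<close> takes its ranges from values of \<open>t\<close>: at \<open>x\<close> its range is that of
  \<open>t(s(x) x)\<close>, which for \<open>t\<close> in \<open>SG'\<close> is the source of \<open>s(x) x\<close>, that is, of \<open>x\<close>.\<close>

lemma SG_mult_in_SG':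
  assumes s: "s \<in> carrier (SG G)" and t: "t \<in> carrier (SG G)" "t \<in> carrier (SG' G)"
  shows "s \<otimes>\<^bsub>SG G\<^esub> t \<in> carrier (SG' G)"
proof -
  have "s \<otimes>\<^bsub>SG G\<^esub> t \<in> carrier (SG G)"
    using s t(1) by (rule SG_mult_closed)
  moreover have "rng G (t (s x \<cdot> x) \<cdot> s x) = src G x" if x: "x \<in> arrows G" for x
  proof -
    have sx: "(s x, x) \<in> composable G"
      using s x by (rule SG_composable)
    have "rng G (t (s x \<cdot> x) \<cdot> s x) = rng G (t (s x \<cdot> x))"
      using SG_mult_composable[OF s t(1) x] by (rule rng_gmult)
    also have "\<dots> = src G (s x \<cdot> x)"
      using t(2) gmult_closed[OF sx] by (auto simp: SG'_def rng_fibre_def)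
    also have "\<dots> = src G x"
      using sx by (rule src_gmult)
    finally show ?thesis .
  qed
  ultimately show ?thesis
    by (auto simp: SG_def SG'_def src_fibre_def rng_fibre_def)
qed

section \<open>The inversion as an element of the monoid\<close>

lemma jmap_in_SG: "jmap G \<in> carrier (SG G)"
  unfolding jmap_def using continuous_ginv src_ginv by (rule restrict_in_SG)

lemma right_zero_jmap: "right_zero (SG G) (jmap G)"
  unfolding right_zero_def
proof (intro conjI ballI jmap_in_SG)
  fix s assume s: "s \<in> carrier (SG G)"
  show "s \<otimes>\<^bsub>SG G\<^esub> jmap G = jmap G"
  proof (rule SG_eqI)
    fix x assume x: "x \<in> arrows G"
    have "(s x, x) \<in> composable G"
      using s x by (rule SG_composable)
    then show "(s \<otimes>\<^bsub>SG G\<^esub> jmap G) x = jmap G x"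
      using x by (simp add: jmap_def gmult_closed ginv_gmult_cancel_left)
  qed (intro SG_mult_closed s jmap_in_SG)+
qed

lemma jmap_mult_apply:
  "x \<in> arrows G \<Longrightarrow> (jmap G \<otimes>\<^bsub>SG G\<^esub> f) x = f (src G x) \<cdot> ginv G x"
  by (simp add: jmap_def src_def)

lemma SG_src_composable:
  assumes "f \<in> carrier (SG G)" "x \<in> arrows G"
  shows "(f (src G x), ginv G x) \<in> composable G"
  using assms SG_fibre[OF assms(1) src_closed[OF assms(2)]]
  by (simp add: composable_iff ginv_closed rng_src rng_ginv)

lemma left_zero_jmap_iff:
  "left_zero (SG G) (jmap G) \<longleftrightarrow> (\<forall>f\<in>carrier (SG G). \<forall>u\<in>unit_space G. f u = u)"
proof -
  have "jmap G \<otimes>\<^bsub>SG G\<^esub> f = jmap G \<longleftrightarrow> (\<forall>u\<in>unit_space G. f u = u)"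
    if f: "f \<in> carrier (SG G)" for f
  proof -
    have "jmap G \<otimes>\<^bsub>SG G\<^esub> f = jmap G \<longleftrightarrow>
        (\<forall>x\<in>arrows G. f (src G x) \<cdot> ginv G x = ginv G x)"
    proof
      assume "jmap G \<otimes>\<^bsub>SG G\<^esub> f = jmap G"
      then show "\<forall>x\<in>arrows G. f (src G x) \<cdot> ginv G x = ginv G x"
        using jmap_mult_apply by (metis jmap_def restrict_apply')
    next
      assume *: "\<forall>x\<in>arrows G. f (src G x) \<cdot> ginv G x = ginv G x"
      show "jmap G \<otimes>\<^bsub>SG G\<^esub> f = jmap G"
      proof (rule SG_eqI)
        fix x assume "x \<in> arrows G"
        then show "(jmap G \<otimes>\<^bsub>SG G\<^esub> f) x = jmap G x"
          using * by (simp only: jmap_mult_apply) (simp add: jmap_def)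
      qed (intro SG_mult_closed f jmap_in_SG)+
    qed
    also have "\<dots> \<longleftrightarrow> (\<forall>x\<in>arrows G. f (src G x) = src G x)"
      using left_unit_unique[OF SG_src_composable[OF f]] rng_left_unit ginv_closed rng_ginv
      by metis
    also have "\<dots> \<longleftrightarrow> (\<forall>u\<in>unit_space G. f u = u)"
      by (simp add: unit_space_eq_src)
    finally show ?thesis .
  qed
  then show ?thesis
    using jmap_in_SG by (auto simp: left_zero_def)
qed

section \<open>Antihomomorphisms in the monoid\<close>

lemma antihom_jmap: "antihom G (jmap G)"
proof -
  have "(ginv G y, ginv G x) \<in> composable G \<and> ginv G (x \<cdot> y) = ginv G y \<cdot> ginv G x"
    if xy: "(x, y) \<in> composable G" for x y
  proof -
    have x: "x \<in> arrows G" and y: "y \<in> arrows G"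
      using xy composable_arrows by auto
    have "(ginv G (x \<cdot> y), x) \<in> composable G"
      using xy x y by (simp add: composable_iff ginv_closed src_ginv gmult_closed rng_gmult)
    from ginv_right_cancel[OF this] show ?thesis
      using xy x y by (simp add: composable_iff ginv_closed src_ginv rng_ginv
          ginv_gmult_cancel_left)
  qed
  then show ?thesis
    using composable_arrows gmult_closed ginv_closed by (simp add: antihom_def jmap_def)
qed

lemma antihom_SG_apply:
  assumes "antihom G f" "f \<in> carrier (SG G)" "x \<in> arrows G"
  shows "(f x, f (f x)) \<in> composable G" "f (f x \<cdot> x) = f x \<cdot> f (f x)"
  using assms SG_composable unfolding antihom_def by blast+

lemma inj_antihom_idempotent_eq_jmap:
  assumes f: "f \<in> carrier (SG G)" and inj: "inj_on f (arrows G)" and anti: "antihom G f"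
    and idem: "idempotent_elem (SG G) f"
  shows "f = jmap G"
proof (rule SG_eqI[OF f jmap_in_SG])
  fix x assume x: "x \<in> arrows G"
  have "(f \<otimes>\<^bsub>SG G\<^esub> f) x = f x"
    using idem by (simp only: idempotent_elem_def)
  then have "f (f x \<cdot> x) \<cdot> f x = f x"
    using x by simp
  then have "f (f x \<cdot> x) = rng G (f x)"
    using SG_mult_composable[OF f f x] by (intro left_unit_unique)
  then have "f (f x) = ginv G (f x)"
    using antihom_SG_apply[OF anti f x] by (intro right_inverse_unique) auto
  then have "f (f x) = f (ginv G x)"
    using antihom_ginv[OF anti x] by simp
  then show "f x = jmap G x"
    using inj x SG_fibre(1)[OF f x] ginv_closed[OF x] by (simp add: inj_on_eq_iff jmap_def)
qed

lemma antihom_right_zero_eq_jmap: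
  assumes f: "f \<in> carrier (SG G)" and anti: "antihom G f" and zero: "right_zero (SG G) f"
  shows "f = jmap G"
proof (rule SG_eqI[OF f jmap_in_SG])
  fix x assume x: "x \<in> arrows G"
  have fx: "f x \<in> arrows G"
    using f x by (rule SG_fibre)
  have "jmap G \<otimes>\<^bsub>SG G\<^esub> f = f"
    using zero jmap_in_SG by (simp only: right_zero_def)
  then have eq: "f x = f (src G x) \<cdot> ginv G x"
    using jmap_mult_apply[OF x, of f] by simp
  \<comment> \<open>The unit \<open>f(d(x))\<close> has source \<open>d(x)\<close>, so it is \<open>d(x)\<close>.\<close>
  have "f (src G x) = src G (f (src G x))"
    using antihom_src[OF anti x] src_rng[OF fx] by simp
  also have "\<dots> = rng G (ginv G x)"
    using SG_src_composable[OF f x] by (simp add: composable_iff)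
  finally show "f x = jmap G x"
    using eq x rng_left_unit[OF ginv_closed[OF x]] by (simp add: jmap_def)
qed

text \<open>Both squares send \<open>x\<close> to \<open>f(x) f(f(x)) f(x)\<close>.\<close>

lemma antihom_squares_eq:
  assumes f: "f \<in> carrier (SG G)" "f \<in> carrier (SG' G)" and anti: "antihom G f"
  shows "f \<otimes>\<^bsub>SG' G\<^esub> f = f \<otimes>\<^bsub>SG G\<^esub> f"
proof -
  have "f x \<cdot> f (x \<cdot> f x) = f (f x \<cdot> x) \<cdot> f x" if x: "x \<in> arrows G" for x
  proof -
    have "(x, f x) \<in> composable G"
      using f(2) x by (auto simp: SG'_def rng_fibre_def composable_iff)
    then have "(f (f x), f x) \<in> composable G" "f (x \<cdot> f x) = f (f x) \<cdot> f x"
      using anti unfolding antihom_def by blast+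
    then show ?thesis
      using assoc_composable[OF antihom_SG_apply(1)[OF anti f(1) x]]
        antihom_SG_apply(2)[OF anti f(1) x] by simp
  qed
  then show ?thesis
    by (auto simp: SG'_def intro: restrict_ext)
qed

section \<open>Inverses of bijections in the monoid\<close>

lemma inverse_map_rng_fibre:
  assumes \<phi>: "\<phi> \<in> carrier (SG G)" and bij: "bij_betw \<phi> (arrows G) (arrows G)"
    and x: "x \<in> arrows G"
  shows "inverse_map G \<phi> x \<in> rng_fibre G (src G x)"
proof -
  define y where "y = inv_into (arrows G) \<phi> x"
  have y: "y \<in> arrows G" "\<phi> y = x"
    using bij x unfolding y_def
    by (auto simp: bij_betw_def inv_into_into f_inv_into_f)
  then show ?thesis
    using SG_fibre(2)[OF \<phi> y(1)] x by (simp add: inverse_map_def rng_fibre_def y_def)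
qed

lemma inverse_map_in_SG':
  assumes \<phi>: "\<phi> \<in> carrier (SG G)" and bij: "bij_betw \<phi> (arrows G) (arrows G)"
    and homeo: "homeomorphic_map (topo G) (topo G) \<phi>"
  shows "inverse_map G \<phi> \<in> carrier (SG' G)"
proof -
  obtain \<psi> where \<psi>: "homeomorphic_maps (topo G) (topo G) \<phi> \<psi>"
    using homeo by (auto simp: homeomorphic_map_maps)
  have "continuous_map (topo G) (topo G) (inverse_map G \<phi>)"
  proof (rule continuous_map_eq)
    show "continuous_map (topo G) (topo G) \<psi>"
      using \<psi> by (simp add: homeomorphic_maps_def)
    fix x assume x: "x \<in> topspace (topo G)"
    then have "\<psi> x \<in> arrows G" "\<phi> (\<psi> x) = x"
      using \<psi> by (auto simp: homeomorphic_maps_def continuous_map_def arrows_def)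
    then show "\<psi> x = inverse_map G \<phi> x"
      using bij x by (metis inverse_map_def arrows_def restrict_apply' bij_betw_inv_into_left)
  qed
  then show ?thesis
    using inverse_map_rng_fibre[OF \<phi> bij]
    by (auto simp: SG'_def cmaps_def inverse_map_def)
qed

end

section \<open>Right zeros and minimal ideals\<close>

lemma right_zero_idempotent: "right_zero S z \<Longrightarrow> idempotent_elem S z"
  by (simp add: right_zero_def idempotent_elem_def)

text \<open>The set \<open>z S\<close> is a left ideal since \<open>s z t = z t\<close>. An ideal with an element \<open>t\<close> contains
  \<open>t z = z\<close>, hence all of \<open>z S\<close>.\<close>

lemma (in monoid) right_zero_minimal_ideal:
  assumes "right_zero G z"
  shows "minimal_ideal G {z \<otimes> f | f. f \<in> carrier G}"
proof -
  let ?T = "{z \<otimes> f | f. f \<in> carrier G}"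
  have z: "z \<in> carrier G" and zero: "\<And>s. s \<in> carrier G \<Longrightarrow> s \<otimes> z = z"
    using assms by (auto simp: right_zero_def)
  have "?T \<noteq> {}" "?T \<subseteq> carrier G"
    using z by auto
  moreover have "s \<otimes> (z \<otimes> f) = z \<otimes> f" "(z \<otimes> f) \<otimes> s = z \<otimes> (f \<otimes> s)"
    if "s \<in> carrier G" "f \<in> carrier G" for s f
    using that z zero by (simp_all add: m_assoc flip: m_assoc[of s z f])
  ultimately have "two_sided_ideal G ?T"
    unfolding two_sided_ideal_def left_ideal_def right_ideal_def by fastforce
  moreover have "?T \<subseteq> I" if I: "two_sided_ideal G I" for I
  proof -
    obtain t where t: "t \<in> I" "t \<in> carrier G"
      using I unfolding two_sided_ideal_def left_ideal_def by blast
    have right: "\<And>a s. a \<in> I \<Longrightarrow> s \<in> carrier G \<Longrightarrow> a \<otimes> s \<in> I"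
      using I unfolding two_sided_ideal_def right_ideal_def by blast
    have "z \<in> I"
      using right[OF t(1) z] zero[OF t(2)] by simp
    then show ?thesis
      using right by blast
  qed
  ultimately show ?thesis
    unfolding minimal_ideal_def by blast
qed

section \<open>The intersection of the two monoids\<close>

lemma (in lch_groupoid) jmap_in_SG': "jmap G \<in> carrier (SG' G)"
  using lch_groupoid.jmap_in_SG[OF lch_groupoid_opposite] by simp

lemma (in lch_groupoid) left_ideal_SG_Int_SG':
  "left_ideal (SG G) (carrier (SG G) \<inter> carrier (SG' G))"
proof -
  have "jmap G \<in> carrier (SG G) \<inter> carrier (SG' G)"
    using jmap_in_SG jmap_in_SG' by blast
  then show ?thesis
    unfolding left_ideal_def using SG_mult_closed SG_mult_in_SG' by blast
qed

theorem proposition3p3: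
  fixes G :: "('a, 'b) groupoid_scheme"
  assumes "lch_groupoid G"
  shows
    "(jmap G \<in> carrier (SG G) \<inter> carrier (SG' G) \<and>
      idempotent_elem (SG G) (jmap G) \<and> right_zero (SG G) (jmap G) \<and>
      idempotent_elem (SG' G) (jmap G) \<and> right_zero (SG' G) (jmap G)) \<and>

     (left_zero (SG G) (jmap G) \<longleftrightarrow> (\<forall>f\<in>carrier (SG G). \<forall>u\<in>unit_space G. f u = u)) \<and>
     (left_zero (SG' G) (jmap G) \<longleftrightarrow> (\<forall>f\<in>carrier (SG' G). \<forall>u\<in>unit_space G. f u = u)) \<and>

     left_ideal (SG G) (carrier (SG G) \<inter> carrier (SG' G)) \<and>
     left_ideal (SG' G) (carrier (SG G) \<inter> carrier (SG' G)) \<and>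

     minimal_ideal (SG G) {jmap G \<otimes>\<^bsub>SG G\<^esub> f | f. f \<in> carrier (SG G)} \<and>
     minimal_ideal (SG' G) {jmap G \<otimes>\<^bsub>SG' G\<^esub> f | f. f \<in> carrier (SG' G)} \<and>

     (\<forall>\<phi>\<in>carrier (SG G). bij_betw \<phi> (arrows G) (arrows G) \<longrightarrow>
       (\<forall>x\<in>arrows G. inverse_map G \<phi> x \<in> rng_fibre G (src G x)) \<and>
       (homeomorphic_map (topo G) (topo G) \<phi> \<longrightarrow> inverse_map G \<phi> \<in> carrier (SG' G))) \<and>

     {f \<in> carrier (SG G). inj_on f (arrows G) \<and> antihom G f \<and> idempotent_elem (SG G) f} = {jmap G} \<and>

     {f \<in> carrier (SG G). antihom G f \<and> right_zero (SG G) f} = {jmap G} \<and>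

     (\<forall>f\<in>carrier (SG G) \<inter> carrier (SG' G). antihom G f \<longrightarrow> f \<otimes>\<^bsub>SG' G\<^esub> f = f \<otimes>\<^bsub>SG G\<^esub> f)"
proof -
  interpret lch_groupoid G by fact
  interpret op: lch_groupoid "opposite G" by (rule lch_groupoid_opposite)
  interpret SG: monoid "SG G" by (rule monoid_SG)
  interpret SG': monoid "SG' G" using op.monoid_SG by simp
  have zero: "right_zero (SG G) (jmap G)" "right_zero (SG' G) (jmap G)"
    using right_zero_jmap op.right_zero_jmap by (simp_all only: SG_opposite jmap_opposite)
  have idem: "idempotent_elem (SG G) (jmap G)" "idempotent_elem (SG' G) (jmap G)"
    using zero by (auto intro: right_zero_idempotent)
  have left_zero': "left_zero (SG' G) (jmap G) \<longleftrightarrow>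
      (\<forall>f\<in>carrier (SG' G). \<forall>u\<in>unit_space G. f u = u)"
    using op.left_zero_jmap_iff by (simp only: SG_opposite jmap_opposite unit_space_opposite)
  have left_ideal': "left_ideal (SG' G) (carrier (SG G) \<inter> carrier (SG' G))"
    using op.left_ideal_SG_Int_SG' by (simp only: SG_opposite SG'_opposite Int_commute)
  have inj: "inj_on (jmap G) (arrows G)"
    unfolding inj_on_def jmap_def by (metis ginv_ginv restrict_apply')
  have "{f \<in> carrier (SG G). inj_on f (arrows G) \<and> antihom G f \<and> idempotent_elem (SG G) f}
      = {jmap G}"
    using inj_antihom_idempotent_eq_jmap jmap_in_SG inj antihom_jmap idem(1) by blast
  moreover have "{f \<in> carrier (SG G). antihom G f \<and> right_zero (SG G) f} = {jmap G}"
    using antihom_right_zero_eq_jmap jmap_in_SG antihom_jmap zero(1) by blast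
  ultimately show ?thesis
    using jmap_in_SG jmap_in_SG' zero idem left_zero_jmap_iff left_zero' left_ideal_SG_Int_SG'
      left_ideal' SG.right_zero_minimal_ideal[OF zero(1)] SG'.right_zero_minimal_ideal[OF zero(2)]
      inverse_map_rng_fibre inverse_map_in_SG' antihom_squares_eq
    by (intro conjI ballI impI; (elim IntE)?; assumption?) blast+
qed

end
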